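(* Let $d\ge 1$ be an integer, let $X=\{X_i\}_{i\in\mathbb{Z}^d}$ be an i.i.d. process taking values in a measurable space $U$, and let $Y=\{Y_i\}_{i\in\mathbb{Z}^d}$ be a process taking values in a bounded interval $V\subset\mathbb{R}$ which is a finitary factor of $X$. Then $Y$ has usual large deviation behavior; that is, for every $\epsilon>0$ there exist constants $C,c>0$ such that for all integers $n\ge 1$, $$ \mathbf{P}\left(\left|\frac{1}{n^d}\sum_{i\in\{1,\dots,n\}^d} Y_i-\mathbf{E}[Y_0]\right|>\epsilon\right)\le C e^{-c\,n^d}. $$
   Context: Let $X=\{X_i\}_{i\in\mathbb{Z}^d}$ and $Y=\{Y_i\}_{i\in\mathbb{Z}^d}$ be stationary fields taking values in measurable spaces $U$ and $V$ respectively (an interval of $\mathbb{R}$ carries its Borel $\sigma$-algebra, and $U^{\mathbb{Z}^d}$, $V^{\mathbb{Z}^d}$ carry the product $\sigma$-algebras). Factor: $Y$ is a factor of $X$ if there is a measurable map $f:U^{\mathbb{Z}^d}\to V^{\mathbb{Z}^d}$ which is equivariant (it commutes with all shifts of $\mathbb{Z}^d$) such that $f(X)$ has the same law as $Y$. Such an $f$ is called a factor map. Finitary factor: $Y$ is a finitary factor of $X$ if the factor map $f$ can be chosen so that, almost surely, the coordinate $f(X)_0$ is determined by the restriction of $X$ to a sufficiently large (random) finite box around $0$. In terms of a "stopping box", this means: there is a random variable $N_0$, a measurable function of $X$ with values in $\{0,1,2,\dots\}\cup\{\infty\}$, with $N_0<\infty$ almost surely, such that for every integer $m\ge 0$ the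 event $\{N_0\le m\}$ and the random variable $f(X)_0\,\mathbf{1}_{\{N_0\le m\}}$ are measurable with respect to the $\sigma$-algebra generated by $\{X_i : i\in[-m,m]^d\cap\mathbb{Z}^d\}$. Usual large deviation behavior: for each fixed $\epsilon>0$, the probability that the average of the process over the box $\{1,\dots,n\}^d$ differs from the mean $\mathbf{E}[Y_0]$ by more than $\epsilon$ decays exponentially in the number of sites $n^d$ of the box (for $d=1$: the average between time $1$ and $n$, with decay exponential in $n$). *)

theory Defs
  imports "HOL-Probability.Probability"
begin

text \<open>The lattice of dimension \<open>d\<close> is the type \<open>int ^ 'd\<close> with \<open>d = CARD('d)\<close>, so \<open>d \<ge> 1\<close>.
  A field is a family \<open>X :: int ^ 'd \<Rightarrow> 'a \<Rightarrow> 'u\<close> of functions on a sample space.\<close>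

abbreviation config_space :: "'u measure \<Rightarrow> ((int ^ 'd::finite) \<Rightarrow> 'u) measure" where
  "config_space U \<equiv> \<Pi>\<^sub>M i\<in>UNIV. U"

definition config :: "((int ^ 'd::finite) \<Rightarrow> 'a \<Rightarrow> 'u) \<Rightarrow> 'a \<Rightarrow> ((int ^ 'd) \<Rightarrow> 'u)" where
  "config X \<omega> = (\<lambda>i. X i \<omega>)"

definition shift :: "(int ^ 'd::finite) \<Rightarrow> ((int ^ 'd) \<Rightarrow> 'u) \<Rightarrow> ((int ^ 'd) \<Rightarrow> 'u)" where
  "shift k x = (\<lambda>i. x (i + k))"

definition iid_field ::
  "'a measure \<Rightarrow> 'u measure \<Rightarrow> ((int ^ 'd::finite) \<Rightarrow> 'a \<Rightarrow> 'u) \<Rightarrow> bool" where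
  "iid_field M U X \<longleftrightarrow>
     prob_space M \<and> prob_space.indep_vars M (\<lambda>_. U) X UNIV \<and>
     (\<forall>i. distr M U (X i) = distr M U (X 0))"

text \<open>Only the laws of the two fields matter, so \<open>X\<close> and \<open>Y\<close> may live on different
  probability spaces \<open>M\<close> and \<open>P\<close>.\<close>

definition factor_map ::
  "'a measure \<Rightarrow> 'u measure \<Rightarrow> ((int ^ 'd::finite) \<Rightarrow> 'a \<Rightarrow> 'u) \<Rightarrow>
   'b measure \<Rightarrow> 'v measure \<Rightarrow> ((int ^ 'd) \<Rightarrow> 'b \<Rightarrow> 'v) \<Rightarrow>
   (((int ^ 'd) \<Rightarrow> 'u) \<Rightarrow> ((int ^ 'd) \<Rightarrow> 'v)) \<Rightarrow> bool" where
  "factor_map M U X P V Y f \<longleftrightarrow>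
     f \<in> config_space U \<rightarrow>\<^sub>M config_space V \<and>
     (\<forall>k. \<forall>x\<in>space (config_space U). f (shift k x) = shift k (f x)) \<and>
     distr M (config_space V) (\<lambda>\<omega>. f (config X \<omega>)) = distr P (config_space V) (config Y)"

definition centered_box :: "nat \<Rightarrow> (int ^ 'd::finite) set" where
  "centered_box m = {i. \<forall>k. - int m \<le> i $ k \<and> i $ k \<le> int m}"

definition positive_box :: "nat \<Rightarrow> (int ^ 'd::finite) set" where
  "positive_box n = {i. \<forall>k. 1 \<le> i $ k \<and> i $ k \<le> int n}"

definition generated_algebra ::
  "'a measure \<Rightarrow> 'u measure \<Rightarrow> ((int ^ 'd::finite) \<Rightarrow> 'a \<Rightarrow> 'u) \<Rightarrow> (int ^ 'd) set \<Rightarrow> 'a measure" where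
  "generated_algebra M U X B =
     sigma (space M) (\<Union>i\<in>B. {X i -` A \<inter> space M | A. A \<in> sets U})"

text \<open>The stopping box size is \<open>N (config X \<omega>)\<close>, a measurable function of the configuration.
  The target \<open>V\<close> is a \<open>\<sigma>\<close>-algebra on a set of reals, so that the truncation
  of \<open>f (config X \<omega>) 0\<close> by an indicator makes sense as a real random variable.\<close>

definition finitary_factor ::
  "'a measure \<Rightarrow> 'u measure \<Rightarrow> ((int ^ 'd::finite) \<Rightarrow> 'a \<Rightarrow> 'u) \<Rightarrow>
   'b measure \<Rightarrow> real measure \<Rightarrow> ((int ^ 'd) \<Rightarrow> 'b \<Rightarrow> real) \<Rightarrow> bool" where
  "finitary_factor M U X P V Y \<longleftrightarrow>
     (\<exists>f. factor_map M U X P V Y f \<and>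
       (\<exists>N \<in> config_space U \<rightarrow>\<^sub>M count_space (UNIV :: enat set).
          (AE \<omega> in M. N (config X \<omega>) < \<infinity>) \<and>
          (\<forall>m::nat.
             {\<omega> \<in> space M. N (config X \<omega>) \<le> enat m}
               \<in> sets (generated_algebra M U X (centered_box m)) \<and>
             (\<lambda>\<omega>. f (config X \<omega>) 0 * indicator {\<omega>. N (config X \<omega>) \<le> enat m} \<omega>)
               \<in> borel_measurable (generated_algebra M U X (centered_box m)))))"

definition usual_large_deviations ::
  "'b measure \<Rightarrow> ((int ^ 'd::finite) \<Rightarrow> 'b \<Rightarrow> real) \<Rightarrow> bool" where
  "usual_large_deviations P Y \<longleftrightarrow>
     (\<forall>\<epsilon>>0. \<exists>C>0. \<exists>c>0. \<forall>n::nat. n \<ge> 1 \<longrightarrow>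
        measure P {\<omega> \<in> space P.
            \<bar>(1 / real n ^ CARD('d)) * (\<Sum>i\<in>positive_box n. Y i \<omega>) - (LINT \<omega>|P. Y 0 \<omega>)\<bar> > \<epsilon>}
          \<le> C * exp (- c * real n ^ CARD('d)))"

end

theory Submission imports Defs
begin

text \<open>The theorem holds because the stopping box gives an approximation by local observables in which
  the error is itself local. Write the factor as \<open>Y\<^sub>i = F (shift i X)\<close>, with \<open>\<bar>F\<bar> \<le> B\<close>, and fix a
  scale \<open>m\<close>. Then \<open>G = F \<cdot> 1{N \<le> m}\<close> and \<open>W = 1{N > m}\<close> are both functions of the restriction of \<open>X\<close>
  to the box \<open>[-m, m]\<^sup>d\<close>, and \<open>\<bar>F - G\<bar> \<le> B W\<close>. Hence the box average of \<open>F\<close> deviates from its mean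
  by at most the deviation of the average of \<open>G\<close>, plus \<open>B\<close> times the deviation of the average of \<open>W\<close>,
  plus \<open>2 B E[W]\<close>. As \<open>N\<close> is almost surely finite, the last term is small for large \<open>m\<close>
  (\<open>finite_stopping_tail\<close>), and it is enough to control averages of local observables.

  For these (\<open>local_observable_large_deviations\<close>), colour the lattice by the residues of the
  coordinates modulo \<open>2 m + 1\<close>. Sites of the same colour have disjoint boxes, so their values
  are independent, and Hoeffding's inequality applies to each of the finitely many colours; a large
  deviation of the whole sum forces one of some colour (\<open>coloured_Hoeffding\<close>).

  The stopping property speaks of the value at the site \<open>0\<close> only, through a \<open>\<sigma>\<close>-algebra on the sample
  space. To move it to another site, the observable is first written as a function of the
  coordinates in the box (\<open>real_function_of_vimage_algebra\<close>), and this identity, which holds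
  almost surely for the law of \<open>X\<close>, is then transported by the shift invariance of that law
  (\<open>iid_field_shift_law\<close>).\<close>

section \<open>Factoring measurable functions through a generating map\<close>

text \<open>This is the Doob--Dynkin lemma. The sets \<open>{h < q}\<close> with \<open>q\<close> rational are preimages of sets
  \<open>A q\<close>, and \<open>h\<close> is recovered from the membership of \<open>T \<omega>\<close> in these countably many sets by
  \<open>h \<omega> = inf {q. T \<omega> \<in> A q}\<close>. The infimum is taken in the extended reals since it may be infinite
  at points outside the range of \<open>T\<close>.\<close>

lemma real_function_of_vimage_algebra:
  fixes h :: "'a \<Rightarrow> real"
  assumes T: "T \<in> \<Omega> \<rightarrow> space N"
    and h: "h \<in> borel_measurable (vimage_algebra \<Omega> T N)"
  obtains g where "g \<in> borel_measurable N" "\<And>\<omega>. \<omega> \<in> \<Omega> \<Longrightarrow> h \<omega> = g (T \<omega>)"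
proof -
  have "\<exists>A\<in>sets N. {\<omega>\<in>\<Omega>. h \<omega> < q} = T -` A \<inter> \<Omega>" for q
  proof -
    have "{\<omega>\<in>space (vimage_algebra \<Omega> T N). h \<omega> < q} \<in> sets (vimage_algebra \<Omega> T N)"
      using h by measurable
    then show ?thesis
      by (auto simp: sets_vimage_algebra2[OF T])
  qed
  then obtain A where A: "\<And>q. A q \<in> sets N" "\<And>q. {\<omega>\<in>\<Omega>. h \<omega> < q} = T -` A q \<inter> \<Omega>"
    by metis
  define G where "G y = (INF q\<in>\<rat>. if y \<in> A q then ereal q else \<infinity>)" for y
  have [measurable]: "A q \<in> sets N" for q
    by (rule A)
  have [measurable]: "G \<in> borel_measurable N"
    unfolding G_def by (intro borel_measurable_INF countable_rat) measurable
  have "G (T \<omega>) = ereal (h \<omega>)" if \<omega>: "\<omega> \<in> \<Omega>" for \<omega>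
  proof -
    have iff: "T \<omega> \<in> A q \<longleftrightarrow> h \<omega> < q" for q
      using A(2)[of q] \<omega> by blast
    show ?thesis
      unfolding G_def iff
    proof (rule antisym)
      show "(INF q\<in>\<rat>. if h \<omega> < q then ereal q else \<infinity>) \<le> ereal (h \<omega>)"
      proof (rule ereal_le_epsilon2)
        fix e :: real assume "0 < e"
        then obtain q where q: "q \<in> \<rat>" "h \<omega> < q" "q < h \<omega> + e"
          using Rats_dense_in_real[of "h \<omega>" "h \<omega> + e"] by auto
        have "(INF q\<in>\<rat>. if h \<omega> < q then ereal q else \<infinity>) \<le> ereal q"
          using q by (intro INF_lower2[of q]) auto
        also have "\<dots> \<le> ereal (h \<omega>) + ereal e"
          using q by simp
        finally show "(INF q\<in>\<rat>. if h \<omega> < q then ereal q else \<infinity>) \<le> ereal (h \<omega>) + ereal e" .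
      qed
    next
      show "ereal (h \<omega>) \<le> (INF q\<in>\<rat>. if h \<omega> < q then ereal q else \<infinity>)"
        by (rule INF_greatest) simp
    qed
  qed
  then have "h \<omega> = real_of_ereal (G (T \<omega>))" if "\<omega> \<in> \<Omega>" for \<omega>
    using that by simp
  then show thesis
    by (intro that[of "\<lambda>y. real_of_ereal (G y)"]) auto
qed

lemma generated_algebra_subset_vimage_algebra:
  assumes X: "\<And>i. X i \<in> M \<rightarrow>\<^sub>M U"
  shows "sets (generated_algebra M U X B) \<subseteq>
    sets (vimage_algebra (space M) (\<lambda>\<omega>. \<lambda>i\<in>B. X i \<omega>) (\<Pi>\<^sub>M i\<in>B. U))"
proof -
  let ?T = "\<lambda>\<omega>. \<lambda>i\<in>B. X i \<omega>" and ?N = "\<Pi>\<^sub>M i\<in>B. U"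
  let ?V = "vimage_algebra (space M) ?T ?N"
  have T: "?T \<in> space M \<rightarrow> space ?N"
    using X by (auto simp: space_PiM intro: measurable_space)
  have "X i -` A \<inter> space M \<in> sets ?V" if "i \<in> B" "A \<in> sets U" for i A
  proof -
    have "(\<lambda>x. x i) \<circ> ?T \<in> ?V \<rightarrow>\<^sub>M U"
      using that by (intro measurable_comp[OF measurable_vimage_algebra1[OF T]]
          measurable_component_singleton)
    from measurable_sets[OF this that(2)] show ?thesis
      using that(1) by (simp add: vimage_def)
  qed
  then have "sigma_sets (space M) (\<Union>i\<in>B. {X i -` A \<inter> space M | A. A \<in> sets U}) \<subseteq> sets ?V"
    using sets.sigma_sets_subset[of "\<Union>i\<in>B. {X i -` A \<inter> space M | A. A \<in> sets U}" ?V]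
    by auto
  moreover have "(\<Union>i\<in>B. {X i -` A \<inter> space M | A. A \<in> sets U}) \<subseteq> Pow (space M)"
    by auto
  ultimately show ?thesis
    by (simp add: generated_algebra_def)
qed

section \<open>Hoeffding's inequality for coloured sums\<close>

lemma card_int_cube:
  "finite {v :: int ^ 'd::finite. \<forall>k. a \<le> v $ k \<and> v $ k \<le> b}"
  "card {v :: int ^ 'd::finite. \<forall>k. a \<le> v $ k \<and> v $ k \<le> b} = nat (b - a + 1) ^ CARD('d)"
proof -
  have eq: "{v :: int ^ 'd. \<forall>k. a \<le> v $ k \<and> v $ k \<le> b} = vec_lambda ` (\<Pi>\<^sub>E k\<in>UNIV. {a..b})"
    by (auto simp: PiE_UNIV_domain image_iff intro!: bexI[of _ "vec_nth _"])
  have inj: "inj_on vec_lambda (\<Pi>\<^sub>E k\<in>(UNIV::'d set). {a..b})"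
    by (auto simp: inj_on_def vec_lambda_inject)
  show "finite {v :: int ^ 'd. \<forall>k. a \<le> v $ k \<and> v $ k \<le> b}"
    unfolding eq by (intro finite_imageI finite_PiE) auto
  show "card {v :: int ^ 'd. \<forall>k. a \<le> v $ k \<and> v $ k \<le> b} = nat (b - a + 1) ^ CARD('d)"
    unfolding eq card_image[OF inj] by (simp add: card_PiE)
qed

lemma finite_positive_box: "finite (positive_box n)"
  and card_positive_box: "card (positive_box n :: (int ^ 'd::finite) set) = n ^ CARD('d)"
  unfolding positive_box_def by (simp_all add: card_int_cube)

text \<open>If the whole sum deviates by more than \<open>t\<close>, some colour class deviates by more than
  \<open>t / card L\<close>. Each class is bounded by Hoeffding's inequality, where the number of summands in the
  class is estimated by \<open>card I\<close>: as the number of colours will be fixed while \<open>t\<close> is proportional to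
  \<open>card I\<close>, the exponent stays proportional to \<open>card I\<close> for small and large classes alike.\<close>

lemma (in prob_space) coloured_Hoeffding:
  fixes Z :: "'i \<Rightarrow> 'a \<Rightarrow> real"
  assumes I: "finite I" and L: "finite L" "L \<noteq> {}" and col: "col ` I \<subseteq> L"
    and indep: "\<And>l. l \<in> L \<Longrightarrow> indep_vars (\<lambda>_. borel) Z {i\<in>I. col i = l}"
    and bound: "\<And>i. i \<in> I \<Longrightarrow> AE \<omega> in M. \<bar>Z i \<omega>\<bar> \<le> B"
    and B: "0 < B" and t: "0 < t"
  shows "prob {\<omega>\<in>space M. \<bar>(\<Sum>i\<in>I. Z i \<omega>) - (\<Sum>i\<in>I. expectation (Z i))\<bar> > t}
    \<le> 2 * real (card L) * exp (- (t\<^sup>2 / (2 * B\<^sup>2 * (real (card L))\<^sup>2 * real (card I))))"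
proof -
  define J where "J l = {i\<in>I. col i = l}" for l
  define S where "S l \<omega> = (\<Sum>i\<in>J l. Z i \<omega>) - (\<Sum>i\<in>J l. expectation (Z i))" for l \<omega>
  define s where "s = t / card L"
  have cL: "card L > 0" using L by (simp add: card_gt_0_iff)
  have s: "s > 0" using t cL by (simp add: s_def)
  have finJ: "finite (J l)" for l using I by (simp add: J_def)
  have Zm: "Z i \<in> borel_measurable M" if "i \<in> J l" "l \<in> L" for i l
    using indep[OF that(2)] that(1) unfolding indep_vars_def J_def by blast
  have Sm: "S l \<in> borel_measurable M" if "l \<in> L" for l
    unfolding S_def using Zm[OF _ that]
    by (intro borel_measurable_diff borel_measurable_sum borel_measurable_const) 
  have cover: "{\<omega>\<in>space M. \<bar>(\<Sum>i\<in>I. Z i \<omega>) - (\<Sum>i\<in>I. expectation (Z i))\<bar> > t}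
      \<subseteq> (\<Union>l\<in>L. {\<omega>\<in>space M. \<bar>S l \<omega>\<bar> > s})"
  proof (rule ccontr)
    assume "\<not> ?thesis"
    then obtain \<omega> where \<omega>: "\<bar>(\<Sum>i\<in>I. Z i \<omega>) - (\<Sum>i\<in>I. expectation (Z i))\<bar> > t"
      and small: "\<And>l. l \<in> L \<Longrightarrow> \<bar>S l \<omega>\<bar> \<le> s" by force
    have "(\<Sum>i\<in>I. Z i \<omega>) - (\<Sum>i\<in>I. expectation (Z i)) = (\<Sum>l\<in>L. S l \<omega>)"
      unfolding S_def J_def sum_subtractf by (simp add: sum.group[OF I L(1) col])
    then have "t < \<bar>\<Sum>l\<in>L. S l \<omega>\<bar>" using \<omega> by simp
    also have "\<dots> \<le> (\<Sum>l\<in>L. \<bar>S l \<omega>\<bar>)" by (rule sum_abs)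
    also have "\<dots> \<le> real (card L) * s" using small by (intro sum_bounded_above) auto
    also have "\<dots> = t" using cL by (simp add: s_def)
    finally show False by simp
  qed
  define e where "e = exp (- (t\<^sup>2 / (2 * B\<^sup>2 * (real (card L))\<^sup>2 * real (card I))))"
  have each: "prob {\<omega>\<in>space M. \<bar>S l \<omega>\<bar> > s} \<le> 2 * e" if l: "l \<in> L" for l
  proof (cases "J l = {}")
    case True
    then show ?thesis using s by (simp add: S_def e_def)
  next
    case False
    interpret Hoeffding_ineq M "J l" Z "\<lambda>_. -B" "\<lambda>_. B" "\<Sum>i\<in>J l. expectation (Z i)"
    proof unfold_locales
      show "indep_vars (\<lambda>_. borel) Z (J l)" using indep[OF l] by (simp add: J_def)
      show "AE x in M. Z i x \<in> {- B..B}" if "i \<in> J l" for i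
        using bound[of i] that by (auto simp: J_def abs_le_iff elim: eventually_mono)
    qed (auto simp: finJ)
    have cJ: "0 < card (J l)" "card (J l) \<le> card I"
      using False finJ I by (auto simp: card_gt_0_iff J_def intro: card_mono)
    have sq: "(\<Sum>i\<in>J l. (B - - B)\<^sup>2) = 4 * B\<^sup>2 * card (J l)"
      by (simp add: power2_eq_square)
    have "prob {\<omega>\<in>space M. \<bar>S l \<omega>\<bar> > s} \<le> prob {\<omega>\<in>space M. \<bar>S l \<omega>\<bar> \<ge> s}"
      using Sm[OF l] by (intro finite_measure_mono) auto
    also have "\<dots> \<le> 2 * exp (- 2 * s\<^sup>2 / (\<Sum>i\<in>J l. (B - - B)\<^sup>2))"
      unfolding S_def using s B cJ by (intro Hoeffding_ineq_abs_ge) (simp_all add: sq)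
    also have "\<dots> \<le> 2 * e"
    proof -
      have "t\<^sup>2 / (2 * B\<^sup>2 * (real (card L))\<^sup>2 * real (card I))
          \<le> t\<^sup>2 / (2 * B\<^sup>2 * (real (card L))\<^sup>2 * real (card (J l)))"
        using cJ cL B t by (intro divide_left_mono mult_left_mono mult_pos_pos) auto
      also have "\<dots> = 2 * s\<^sup>2 / (\<Sum>i\<in>J l. (B - - B)\<^sup>2)"
        unfolding sq by (simp add: s_def power_divide)
      finally show ?thesis by (simp add: e_def)
    qed
    finally show ?thesis .
  qed
  have "prob {\<omega>\<in>space M. \<bar>(\<Sum>i\<in>I. Z i \<omega>) - (\<Sum>i\<in>I. expectation (Z i))\<bar> > t}
      \<le> prob (\<Union>l\<in>L. {\<omega>\<in>space M. \<bar>S l \<omega>\<bar> > s})"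
    using Sm by (intro finite_measure_mono[OF cover] sets.finite_UN L) auto
  also have "\<dots> \<le> (\<Sum>l\<in>L. prob {\<omega>\<in>space M. \<bar>S l \<omega>\<bar> > s})"
    using Sm by (intro finite_measure_subadditive_finite L) auto
  also have "\<dots> \<le> (\<Sum>l\<in>L. 2 * e)" by (intro sum_mono each)
  finally show ?thesis by (simp add: e_def)
qed

section \<open>Local observables of an i.i.d. field\<close>

lemma iid_field_measurable:
  assumes "iid_field M U X"
  shows "X i \<in> M \<rightarrow>\<^sub>M U"
  using assms unfolding iid_field_def by (auto simp: prob_space.indep_vars_def)

lemma measurable_config [measurable (raw)]:
  assumes "\<And>i. X i \<in> M \<rightarrow>\<^sub>M U"
  shows "config X \<in> M \<rightarrow>\<^sub>M config_space U"
  unfolding config_def by (intro measurable_PiM_single') (use assms in \<open>auto dest: measurable_space\<close>)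

lemma iid_field_shift_law:
  assumes "iid_field M U X"
  shows "distr M (config_space U) (\<lambda>\<omega>. shift k (config X \<omega>)) = distr M (config_space U) (config X)"
proof -
  interpret prob_space M using assms by (simp add: iid_field_def)
  note X = iid_field_measurable[OF assms]
  have ind: "indep_vars (\<lambda>_. U) X UNIV" and same: "\<And>i. distr M U (X i) = distr M U (X 0)"
    using assms by (auto simp: iid_field_def)
  have "indep_vars (\<lambda>_. U) (\<lambda>i. X (i + k)) UNIV"
  proof -
    have "indep_vars (\<lambda>j. PiM {j + k} (\<lambda>_. U)) (\<lambda>j \<omega>. restrict (\<lambda>i. X i \<omega>) {j + k}) UNIV"
      by (rule indep_vars_restrict[OF ind]) (auto simp: disjoint_family_on_def)
    then have "indep_vars (\<lambda>_. U) (\<lambda>j \<omega>. (\<lambda>x. x (j + k)) (restrict (\<lambda>i. X i \<omega>) {j + k})) UNIV"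
      by (rule indep_vars_compose2) auto
    then show ?thesis by simp
  qed
  then have "distr M (config_space U) (\<lambda>\<omega>. \<lambda>i\<in>UNIV. X (i + k) \<omega>) = (\<Pi>\<^sub>M i\<in>UNIV. distr M U (X (i + k)))"
    using X by (subst (asm) indep_vars_iff_distr_eq_PiM) auto
  moreover have "distr M (config_space U) (\<lambda>\<omega>. \<lambda>i\<in>UNIV. X i \<omega>) = (\<Pi>\<^sub>M i\<in>UNIV. distr M U (X i))"
    using X ind by (subst (asm) indep_vars_iff_distr_eq_PiM) auto
  moreover have "distr M U (X (i + k)) = distr M U (X i)" for i
    using same[of "i + k"] same[of i] by simp
  ultimately show ?thesis
    by (simp add: shift_def config_def[abs_def] restrict_UNIV)
qed


text \<open>If the boxes of radius \<open>m\<close> around \<open>i\<close> and \<open>i'\<close> meet, the coordinates differ by at most \<open>2 m\<close>; a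
  difference divisible by \<open>2 m + 1\<close> is then zero.\<close>

lemma box_colouring:
  fixes i i' j j' :: "int ^ 'd::finite"
  assumes "j \<in> centered_box m" "j' \<in> centered_box m" "j + i = j' + i'"
    and "(\<chi> k. i $ k mod (2 * int m + 1)) = (\<chi> k. i' $ k mod (2 * int m + 1))"
  shows "i = i'"
proof -
  have "i $ k = i' $ k" for k
  proof -
    have "(2 * int m + 1) dvd (i $ k - i' $ k)"
      using assms(4) by (simp add: vec_eq_iff mod_eq_dvd_iff)
    moreover have "\<bar>i $ k - i' $ k\<bar> < 2 * int m + 1"
    proof -
      have "j $ k + i $ k = j' $ k + i' $ k"
        using assms(3) by (metis vector_add_component)
      then show ?thesis
        using assms(1,2) by (auto simp: centered_box_def abs_if dest!: spec[of _ k])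
    qed
    ultimately show ?thesis
      using dvd_imp_le_int[of "i $ k - i' $ k" "2 * int m + 1"] by fastforce
  qed
  then show ?thesis by (simp add: vec_eq_iff)
qed

lemma measurable_shift [measurable]: "shift k \<in> config_space U \<rightarrow>\<^sub>M config_space U"
  unfolding shift_def by (intro measurable_PiM_single') (auto simp: space_PiM)

text \<open>The values \<open>h (shift i (config X \<omega>))\<close> are replaced by \<open>Z i\<close>, which depend only on the
  coordinates in the box around \<open>i\<close>. The two agree almost surely but possibly not everywhere, as
  the range of \<open>config X\<close> need not be invariant under shifts.\<close>

lemma local_observable_large_deviations:
  fixes X :: "(int ^ 'd::finite) \<Rightarrow> 'a \<Rightarrow> 'u" and h :: "((int ^ 'd) \<Rightarrow> 'u) \<Rightarrow> real"
  assumes iid: "iid_field M U X"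
    and h [measurable]: "h \<in> borel_measurable (config_space U)"
    and bound: "\<And>x. x \<in> space (config_space U) \<Longrightarrow> \<bar>h x\<bar> \<le> B"
    and loc: "(\<lambda>\<omega>. h (config X \<omega>)) \<in> borel_measurable (generated_algebra M U X (centered_box m))"
    and "0 < \<epsilon>"
  shows "\<exists>C>0. \<exists>c>0. \<forall>n\<ge>1. measure M {\<omega> \<in> space M.
        \<bar>(1 / real n ^ CARD('d)) * (\<Sum>i\<in>positive_box n. h (shift i (config X \<omega>)))
          - (LINT \<omega>|M. h (config X \<omega>))\<bar> > \<epsilon>} \<le> C * exp (- c * real n ^ CARD('d))"
proof -
  interpret prob_space M using iid by (simp add: iid_field_def)
  note X [measurable] = iid_field_measurable[OF iid]
  let ?C = "config_space U :: ((int ^ 'd) \<Rightarrow> 'u) measure"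
  let ?B = "centered_box m :: (int ^ 'd) set"
  have "subalgebra (vimage_algebra (space M) (\<lambda>\<omega>. \<lambda>i\<in>?B. X i \<omega>) (\<Pi>\<^sub>M i\<in>?B. U))
      (generated_algebra M U X ?B)"
    using generated_algebra_subset_vimage_algebra[of X M U ?B, OF X]
    by (auto simp: subalgebra_def generated_algebra_def space_measure_of_conv)
  from measurable_from_subalg[OF this loc]
  obtain g where g [measurable]: "g \<in> borel_measurable (\<Pi>\<^sub>M i\<in>?B. U)"
    and hg: "\<And>\<omega>. \<omega> \<in> space M \<Longrightarrow> h (config X \<omega>) = g (\<lambda>i\<in>?B. X i \<omega>)"
    by (rule real_function_of_vimage_algebra[rotated])
       (use X in \<open>auto simp: space_PiM intro: measurable_space\<close>)
  define Z where "Z i \<omega> = g (\<lambda>j\<in>?B. X (j + i) \<omega>)" for i \<omega>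
  have [measurable]: "Z i \<in> borel_measurable M" for i
    unfolding Z_def by measurable
  have cfg [measurable]: "config X \<in> M \<rightarrow>\<^sub>M ?C" by measurable
  have AEZ: "AE \<omega> in M. h (shift i (config X \<omega>)) = Z i \<omega>" for i
  proof -
    have "AE x in distr M ?C (config X). h x = g (restrict x ?B)"
    proof (subst AE_distr_iff)
      show "AE \<omega> in M. h (config X \<omega>) = g (restrict (config X \<omega>) ?B)"
        by (rule AE_I2, subst hg) (auto simp: config_def)
    qed auto
    then have "AE x in distr M ?C (\<lambda>\<omega>. shift i (config X \<omega>)). h x = g (restrict x ?B)"
      by (simp only: iid_field_shift_law[OF iid])
    then have "AE \<omega> in M. h (shift i (config X \<omega>)) = g (restrict (shift i (config X \<omega>)) ?B)"
      by (subst (asm) AE_distr_iff) auto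
    then show ?thesis by (simp add: Z_def shift_def config_def restrict_def)
  qed
  have EZ: "expectation (Z i) = (LINT \<omega>|M. h (config X \<omega>))" for i
  proof -
    have "expectation (Z i) = (LINT \<omega>|M. h (shift i (config X \<omega>)))"
      using AEZ[of i] by (intro integral_cong_AE) auto
    also have "\<dots> = (LINT x|distr M ?C (\<lambda>\<omega>. shift i (config X \<omega>)). h x)"
      by (subst integral_distr) auto
    also have "\<dots> = (LINT \<omega>|M. h (config X \<omega>))"
      unfolding iid_field_shift_law[OF iid] by (subst integral_distr) auto
    finally show ?thesis .
  qed
  define K where "K = 2 * int m + 1"
  define col where "col i = (\<chi> k. i $ k mod K)" for i :: "int ^ 'd"
  define L where "L = {v :: int ^ 'd. \<forall>k. 0 \<le> v $ k \<and> v $ k \<le> 2 * int m}"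
  have K: "K > 0" by (simp add: K_def)
  have L: "finite L" unfolding L_def by (rule card_int_cube)
  have colL: "col i \<in> L" for i
  proof -
    have "0 \<le> i $ k mod K" "i $ k mod K \<le> 2 * int m" for k
      using pos_mod_bound[OF K, of "i $ k"] pos_mod_sign[OF K, of "i $ k"] unfolding K_def by linarith+
    then show ?thesis by (simp add: L_def col_def)
  qed
  have cL: "card L > 0"
    using L colL by (auto simp: card_gt_0_iff)
  have indep: "indep_vars (\<lambda>_. borel) Z {i\<in>I. col i = l}" for I l
  proof -
    have "indep_vars (\<lambda>i. PiM ((\<lambda>j. j + i) ` ?B) (\<lambda>_. U))
        (\<lambda>i \<omega>. restrict (\<lambda>k. X k \<omega>) ((\<lambda>j. j + i) ` ?B)) {i\<in>I. col i = l}"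
    proof (rule indep_vars_restrict)
      show "indep_vars (\<lambda>_. U) X UNIV" using iid by (simp add: iid_field_def)
      show "disjoint_family_on (\<lambda>i. (\<lambda>j. j + i) ` ?B) {i \<in> I. col i = l}"
        unfolding disjoint_family_on_def
      proof (intro ballI impI)
        fix i i' assume "i \<in> {i \<in> I. col i = l}" "i' \<in> {i \<in> I. col i = l}" "i \<noteq> i'"
        then show "(\<lambda>j. j + i) ` ?B \<inter> (\<lambda>j. j + i') ` ?B = {}"
          using box_colouring[of _ m _ i i'] by (auto simp: col_def K_def)
      qed
    qed auto
    then have "indep_vars (\<lambda>_. borel) (\<lambda>i \<omega>. (\<lambda>x. g (\<lambda>j\<in>?B. x (j + i)))
        (restrict (\<lambda>k. X k \<omega>) ((\<lambda>j. j + i) ` ?B))) {i\<in>I. col i = l}"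
    proof (rule indep_vars_compose2)
      fix i :: "int ^ 'd"
      have "(\<lambda>x. \<lambda>j\<in>?B. x (j + i)) \<in> PiM ((\<lambda>j. j + i) ` ?B) (\<lambda>_. U) \<rightarrow>\<^sub>M (\<Pi>\<^sub>M i\<in>?B. U)"
        by (intro measurable_restrict measurable_component_singleton) auto
      then show "(\<lambda>x. g (\<lambda>j\<in>?B. x (j + i))) \<in> borel_measurable (PiM ((\<lambda>j. j + i) ` ?B) (\<lambda>_. U))"
        using g by (rule measurable_compose)
    qed
    moreover have "(\<lambda>j\<in>?B. (restrict (\<lambda>k. X k \<omega>) ((\<lambda>j. j + i) ` ?B)) (j + i))
        = (\<lambda>j\<in>?B. X (j + i) \<omega>)" for i \<omega>
      by (auto simp: fun_eq_iff)
    ultimately show ?thesis by (simp add: Z_def[abs_def])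
  qed
  \<comment> \<open>A strictly positive bound, since \<open>B = 0\<close> is possible.\<close>
  define D where "D = \<bar>B\<bar> + 1"
  define c where "c = \<epsilon>\<^sup>2 / (2 * D\<^sup>2 * (real (card L))\<^sup>2)"
  have D: "D > 0" by (simp add: D_def)
  have c: "c > 0" using D cL \<open>0 < \<epsilon>\<close> by (simp add: c_def)
  have bZ: "AE \<omega> in M. \<bar>Z i \<omega>\<bar> \<le> D" for i
    using AEZ[of i] AE_space
  proof eventually_elim
    case (elim \<omega>)
    then have "shift i (config X \<omega>) \<in> space ?C"
      by (intro measurable_space[OF measurable_shift] measurable_space[OF cfg])
    from bound[OF this] elim show ?case by (simp add: D_def)
  qed
  show ?thesis
  proof (rule exI[of _ "2 * real (card L)"], rule conjI, use cL in simp,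
      rule exI[of _ c], rule conjI, use c in simp, intro allI impI)
    fix n :: nat assume n: "n \<ge> 1"
    define I where "I = (positive_box n :: (int ^ 'd) set)"
    define v where "v = real n ^ CARD('d)"
    have v: "v > 0" using n by (simp add: v_def)
    have I: "finite I" "real (card I) = v"
      by (simp_all add: I_def v_def finite_positive_box card_positive_box)
    define e where "e = (LINT \<omega>|M. h (config X \<omega>))"
    have "AE \<omega> in M. \<forall>i\<in>I. h (shift i (config X \<omega>)) = Z i \<omega>"
      using I AEZ by (intro AE_finite_allI) auto
    then have "AE \<omega> in M. (\<bar>1 / v * (\<Sum>i\<in>I. h (shift i (config X \<omega>))) - e\<bar> > \<epsilon>) =
        (\<bar>(\<Sum>i\<in>I. Z i \<omega>) - (\<Sum>i\<in>I. expectation (Z i))\<bar> > \<epsilon> * v)"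
    proof eventually_elim
      case (elim \<omega>)
      then have "1 / v * (\<Sum>i\<in>I. h (shift i (config X \<omega>))) - e
          = ((\<Sum>i\<in>I. Z i \<omega>) - (\<Sum>i\<in>I. expectation (Z i))) / v"
        using v by (simp add: EZ I e_def diff_divide_distrib)
      then show ?case
        using v by (simp add: abs_divide pos_less_divide_eq)
    qed
    then have "prob {\<omega>\<in>space M. \<bar>1 / v * (\<Sum>i\<in>I. h (shift i (config X \<omega>))) - e\<bar> > \<epsilon>} =
        prob {\<omega>\<in>space M. \<bar>(\<Sum>i\<in>I. Z i \<omega>) - (\<Sum>i\<in>I. expectation (Z i))\<bar> > \<epsilon> * v}"
      by (intro finite_measure_eq_AE) (auto elim: eventually_mono)
    also have "\<dots> \<le> 2 * real (card L) *
        exp (- ((\<epsilon> * v)\<^sup>2 / (2 * D\<^sup>2 * (real (card L))\<^sup>2 * real (card I))))"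
      using L colL cL D v \<open>0 < \<epsilon>\<close>
      by (intro coloured_Hoeffding[where col = col] indep bZ I) auto
    also have "(\<epsilon> * v)\<^sup>2 / (2 * D\<^sup>2 * (real (card L))\<^sup>2 * real (card I)) = c * v"
      using v by (simp add: c_def I power2_eq_square)
    finally show "prob {\<omega> \<in> space M.
        \<bar>(1 / real n ^ CARD('d)) * (\<Sum>i\<in>positive_box n. h (shift i (config X \<omega>)))
          - (LINT \<omega>|M. h (config X \<omega>))\<bar> > \<epsilon>} \<le> 2 * real (card L) * exp (- c * real n ^ CARD('d))"
      by (simp add: I_def v_def e_def)
  qed
qed

section \<open>Large deviations of finitary factors\<close>

lemma finite_stopping_tail:
  assumes "prob_space M" and N: "N \<in> M \<rightarrow>\<^sub>M count_space (UNIV :: enat set)"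
    and fin: "AE \<omega> in M. N \<omega> < \<infinity>" and "0 < \<delta>"
  obtains m :: nat where "measure M {\<omega>\<in>space M. \<not> N \<omega> \<le> enat m} < \<delta>"
proof -
  interpret prob_space M by fact
  note N [measurable]
  let ?A = "\<lambda>m::nat. {\<omega>\<in>space M. \<not> N \<omega> \<le> enat m}"
  have A: "?A m \<in> events" for m by measurable
  have "(\<lambda>m. prob (?A m)) \<longlonglongrightarrow> prob (\<Inter>m. ?A m)"
    using A by (intro finite_Lim_measure_decseq) (auto simp: decseq_def intro: order_trans)
  moreover have "prob (\<Inter>m. ?A m) = 0"
  proof -
    have "AE \<omega> in M. \<omega> \<notin> (\<Inter>m. ?A m)"
      using fin by eventually_elim (auto simp: less_infinityE)
    then show ?thesis
      using A by (subst prob_eq_0) auto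
  qed
  ultimately have "\<forall>\<^sub>F m in sequentially. prob (?A m) < \<delta>"
    using \<open>0 < \<delta>\<close> by (intro order_tendstoD) auto
  then show thesis
    using that by (auto simp: eventually_sequentially)
qed

theorem mainTheorem1:
  fixes X :: "(int ^ 'd::finite) \<Rightarrow> 'a \<Rightarrow> 'u"
    and Y :: "(int ^ 'd) \<Rightarrow> 'b \<Rightarrow> real"
    and M :: "'a measure" and P :: "'b measure"
    and U :: "'u measure" and V :: "real set"
  assumes "iid_field M U X"
    and "prob_space P"
    and "is_interval V" and "bounded V"
    and "\<And>i. Y i \<in> P \<rightarrow>\<^sub>M restrict_space borel V"
    and "finitary_factor M U X P (restrict_space borel V) Y"
  shows "usual_large_deviations P Y"
  unfolding usual_large_deviations_def
proof (intro allI impI)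
  fix \<epsilon> :: real assume \<epsilon>: "0 < \<epsilon>"
  let ?C = "config_space U :: ((int ^ 'd) \<Rightarrow> 'u) measure"
  let ?D = "config_space (restrict_space borel V) :: ((int ^ 'd) \<Rightarrow> real) measure"
  interpret prob_space M using assms(1) by (simp add: iid_field_def)
  note X [measurable] = iid_field_measurable[OF assms(1)]
  note Y [measurable] = assms(5)
  obtain f N where fm: "factor_map M U X P (restrict_space borel V) Y f"
    and N [measurable]: "N \<in> ?C \<rightarrow>\<^sub>M count_space (UNIV :: enat set)"
    and fin: "AE \<omega> in M. N (config X \<omega>) < \<infinity>"
    and stop: "\<And>m. {\<omega> \<in> space M. N (config X \<omega>) \<le> enat m}
        \<in> sets (generated_algebra M U X (centered_box m))"
    and det: "\<And>m. (\<lambda>\<omega>. f (config X \<omega>) 0 * indicator {\<omega>. N (config X \<omega>) \<le> enat m} \<omega>)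
        \<in> borel_measurable (generated_algebra M U X (centered_box m))"
    using assms(6) unfolding finitary_factor_def by blast
  have f [measurable]: "f \<in> ?C \<rightarrow>\<^sub>M ?D"
    and equiv: "\<And>k x. x \<in> space ?C \<Longrightarrow> f (shift k x) = shift k (f x)"
    and law: "distr M ?D (\<lambda>\<omega>. f (config X \<omega>)) = distr P ?D (config Y)"
    using fm by (auto simp: factor_map_def)
  have cfg [measurable]: "config X \<in> M \<rightarrow>\<^sub>M ?C" by measurable
  have cfgY [measurable]: "config Y \<in> P \<rightarrow>\<^sub>M ?D" by measurable
  have coord [measurable]: "(\<lambda>y. y i) \<in> borel_measurable ?D" for i
  proof -
    have "(\<lambda>y. y i) \<in> ?D \<rightarrow>\<^sub>M restrict_space borel V"
      by (intro measurable_component_singleton) auto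
    then show ?thesis by (simp add: measurable_restrict_space2_iff)
  qed
  define F where "F x = f x 0" for x
  have [measurable]: "F \<in> borel_measurable ?C"
    unfolding F_def by measurable
  have shiftF: "f x i = F (shift i x)" if "x \<in> space ?C" for x i
    unfolding F_def equiv[OF that] by (simp add: shift_def)
  have FV: "F x \<in> V" if "x \<in> space ?C" for x
    using measurable_space[OF f that] by (auto simp: F_def space_PiM space_restrict_space)
  obtain B where B: "B > 0" and VB: "\<And>v. v \<in> V \<Longrightarrow> \<bar>v\<bar> \<le> B"
    using assms(4) unfolding bounded_pos by auto
  have FB: "\<bar>F x\<bar> \<le> B" if "x \<in> space ?C" for x
    using FV[OF that] VB by blast
  have mean: "(LINT \<omega>|P. Y 0 \<omega>) = (LINT \<omega>|M. F (config X \<omega>))"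
  proof -
    have "(LINT \<omega>|P. Y 0 \<omega>) = (LINT y|distr P ?D (config Y). y 0)"
      by (subst integral_distr) (auto simp: config_def)
    also have "\<dots> = (LINT \<omega>|M. F (config X \<omega>))"
      unfolding law[symmetric] by (subst integral_distr) (auto simp: F_def)
    finally show ?thesis .
  qed
  define \<mu> where "\<mu> = (LINT \<omega>|M. F (config X \<omega>))"
  \<comment> \<open>The deviation event depends on the law of the field only, so it can be studied for \<open>f(X)\<close>.\<close>
  have transfer: "measure P {\<omega> \<in> space P. \<bar>(1 / v) * (\<Sum>i\<in>I. Y i \<omega>) - \<mu>\<bar> > \<epsilon>} =
      prob {\<omega> \<in> space M. \<bar>(1 / v) * (\<Sum>i\<in>I. F (shift i (config X \<omega>))) - \<mu>\<bar> > \<epsilon>}" for v I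
  proof -
    let ?S = "{y \<in> space ?D. \<bar>(1 / v) * (\<Sum>i\<in>I. y i) - \<mu>\<bar> > \<epsilon>}"
    have S: "?S \<in> sets ?D" by measurable
    have "measure P {\<omega> \<in> space P. \<bar>(1 / v) * (\<Sum>i\<in>I. Y i \<omega>) - \<mu>\<bar> > \<epsilon>} =
        measure (distr P ?D (config Y)) ?S"
      using S measurable_space[OF cfgY]
      by (subst measure_distr) (auto simp: config_def intro!: arg_cong[where f = "measure P"])
    also have "\<dots> = prob {\<omega> \<in> space M. \<bar>(1 / v) * (\<Sum>i\<in>I. f (config X \<omega>) i) - \<mu>\<bar> > \<epsilon>}"
      unfolding law[symmetric]
      using S measurable_space[OF measurable_compose[OF cfg f]]
      by (subst measure_distr) (auto intro!: arg_cong[where f = prob])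
    also have "{\<omega> \<in> space M. \<bar>(1 / v) * (\<Sum>i\<in>I. f (config X \<omega>) i) - \<mu>\<bar> > \<epsilon>} =
        {\<omega> \<in> space M. \<bar>(1 / v) * (\<Sum>i\<in>I. F (shift i (config X \<omega>))) - \<mu>\<bar> > \<epsilon>}"
      using shiftF measurable_space[OF cfg] by (intro Collect_cong) auto
    finally show ?thesis .
  qed
  \<comment> \<open>With this choice \<open>2 B E[W] < \<epsilon> / 3\<close>, one third of the admissible deviation.\<close>
  obtain m where m: "prob {\<omega>\<in>space M. \<not> N (config X \<omega>) \<le> enat m} < \<epsilon> / (6 * B)"
    using finite_stopping_tail[of M "\<lambda>\<omega>. N (config X \<omega>)" "\<epsilon> / (6 * B)"]
      prob_space_axioms fin \<epsilon> B by auto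
  define G where "G x = F x * (if N x \<le> enat m then 1 else 0)" for x
  define W where "W x = (if N x \<le> enat m then 0 else 1 :: real)" for x
  have [measurable]: "G \<in> borel_measurable ?C" "W \<in> borel_measurable ?C"
    unfolding G_def W_def by measurable
  have GB: "\<bar>G x\<bar> \<le> B" if "x \<in> space ?C" for x
    using FB[OF that] B by (simp add: G_def)
  have W1: "\<bar>W x\<bar> \<le> 1" for x
    by (simp add: W_def)
  have "(\<lambda>\<omega>. G (config X \<omega>)) \<in> borel_measurable (generated_algebra M U X (centered_box m))"
    using det[of m] by (simp add: G_def F_def indicator_def of_bool_def)
  from local_observable_large_deviations[OF assms(1) _ _ this, of B "\<epsilon> / 3"]
  obtain C1 c1 where 1: "C1 > 0" "c1 > 0"
    "\<And>n. n \<ge> 1 \<Longrightarrow> prob {\<omega> \<in> space M.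
        \<bar>(1 / real n ^ CARD('d)) * (\<Sum>i\<in>positive_box n. G (shift i (config X \<omega>)))
          - (LINT \<omega>|M. G (config X \<omega>))\<bar> > \<epsilon> / 3} \<le> C1 * exp (- c1 * real n ^ CARD('d))"
    using B \<epsilon> \<open>G \<in> borel_measurable ?C\<close> GB by auto
  have "(\<lambda>\<omega>. W (config X \<omega>)) \<in> borel_measurable (generated_algebra M U X (centered_box m))"
  proof -
    have "(\<lambda>\<omega>. 1 - indicator {\<omega> \<in> space M. N (config X \<omega>) \<le> enat m} \<omega> :: real)
        \<in> borel_measurable (generated_algebra M U X (centered_box m))"
      using stop[of m] by measurable
    then show ?thesis
      by (rule measurable_cong[THEN iffD1, rotated])
         (auto simp: W_def generated_algebra_def space_measure_of_conv)
  qed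
  from local_observable_large_deviations[OF assms(1) _ _ this, of 1 "\<epsilon> / (3 * B)"]
  obtain C2 c2 where 2: "C2 > 0" "c2 > 0"
    "\<And>n. n \<ge> 1 \<Longrightarrow> prob {\<omega> \<in> space M.
        \<bar>(1 / real n ^ CARD('d)) * (\<Sum>i\<in>positive_box n. W (shift i (config X \<omega>)))
          - (LINT \<omega>|M. W (config X \<omega>))\<bar> > \<epsilon> / (3 * B)} \<le> C2 * exp (- c2 * real n ^ CARD('d))"
    using B \<epsilon> \<open>W \<in> borel_measurable ?C\<close> W1 by auto
  have GW: "\<bar>F x - G x\<bar> \<le> B * W x" if "x \<in> space ?C" for x
    using FB[OF that] by (simp add: G_def W_def)
  define \<gamma> where "\<gamma> = (LINT \<omega>|M. G (config X \<omega>))"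
  define \<delta> where "\<delta> = (LINT \<omega>|M. W (config X \<omega>))"
  have \<delta>: "\<delta> < \<epsilon> / (6 * B)"
  proof -
    have "\<delta> = (LINT \<omega>|M. indicator {\<omega>\<in>space M. \<not> N (config X \<omega>) \<le> enat m} \<omega>)"
      unfolding \<delta>_def by (intro Bochner_Integration.integral_cong) (auto simp: W_def)
    also have "\<dots> = prob {\<omega>\<in>space M. \<not> N (config X \<omega>) \<le> enat m}"
      by (simp add: Int_absorb1)
    finally show ?thesis using m by simp
  qed
  have int: "integrable M (\<lambda>\<omega>. F (config X \<omega>))" "integrable M (\<lambda>\<omega>. G (config X \<omega>))"
      "integrable M (\<lambda>\<omega>. W (config X \<omega>))"
  proof -
    show "integrable M (\<lambda>\<omega>. F (config X \<omega>))"
      using FB measurable_space[OF cfg] by (intro integrable_const_bound[where B = B] AE_I2) auto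
    show "integrable M (\<lambda>\<omega>. G (config X \<omega>))"
      using GB measurable_space[OF cfg] by (intro integrable_const_bound[where B = B] AE_I2) auto
    show "integrable M (\<lambda>\<omega>. W (config X \<omega>))"
      using W1 by (intro integrable_const_bound[where B = 1] AE_I2) auto
  qed
  have \<mu>\<gamma>: "\<bar>\<mu> - \<gamma>\<bar> \<le> B * \<delta>"
  proof -
    have "\<bar>\<mu> - \<gamma>\<bar> = \<bar>LINT \<omega>|M. F (config X \<omega>) - G (config X \<omega>)\<bar>"
      using int by (simp add: \<mu>_def \<gamma>_def)
    also have "\<dots> \<le> (LINT \<omega>|M. \<bar>F (config X \<omega>) - G (config X \<omega>)\<bar>)"
      by (rule integral_abs_bound)
    also have "\<dots> \<le> (LINT \<omega>|M. B * W (config X \<omega>))"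
      using int GW measurable_space[OF cfg] by (intro integral_mono) auto
    finally show ?thesis by (simp add: \<delta>_def)
  qed
  show "\<exists>C>0. \<exists>c>0. \<forall>n\<ge>1. measure P {\<omega> \<in> space P.
      \<bar>(1 / real n ^ CARD('d)) * (\<Sum>i\<in>positive_box n. Y i \<omega>) - (LINT \<omega>|P. Y 0 \<omega>)\<bar> > \<epsilon>}
      \<le> C * exp (- c * real n ^ CARD('d))"
  proof (rule exI[of _ "C1 + C2"], rule conjI, use 1 2 in simp,
      rule exI[of _ "min c1 c2"], rule conjI, use 1 2 in simp, intro allI impI)
    fix n :: nat assume n: "n \<ge> 1"
    define I where "I = (positive_box n :: (int ^ 'd) set)"
    define v where "v = real n ^ CARD('d)"
    have v: "v > 0" using n by (simp add: v_def)
    have I: "finite I" "real (card I) = v"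
      by (simp_all add: I_def v_def finite_positive_box card_positive_box)
    define avg where "avg H \<omega> = (1 / v) * (\<Sum>i\<in>I. H (shift i (config X \<omega>)))"
      for H :: "_ \<Rightarrow> real" and \<omega>
    have [measurable]: "avg F \<in> borel_measurable M" "avg G \<in> borel_measurable M"
        "avg W \<in> borel_measurable M"
      unfolding avg_def by measurable
    have close: "\<bar>avg F \<omega> - avg G \<omega>\<bar> \<le> B * avg W \<omega>" if "\<omega> \<in> space M" for \<omega>
    proof -
      have "\<bar>\<Sum>i\<in>I. F (shift i (config X \<omega>)) - G (shift i (config X \<omega>))\<bar>
          \<le> (\<Sum>i\<in>I. B * W (shift i (config X \<omega>)))"
        using GW measurable_space[OF measurable_shift measurable_space[OF cfg that]]
        by (intro order_trans[OF sum_abs] sum_mono) auto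
      then show ?thesis
        using v unfolding avg_def right_diff_distrib[symmetric] sum_subtractf[symmetric]
        by (simp add: abs_mult sum_distrib_left[symmetric] divide_right_mono)
    qed
    have "{\<omega>\<in>space M. \<bar>avg F \<omega> - \<mu>\<bar> > \<epsilon>} \<subseteq>
        {\<omega>\<in>space M. \<bar>avg G \<omega> - \<gamma>\<bar> > \<epsilon> / 3} \<union> {\<omega>\<in>space M. \<bar>avg W \<omega> - \<delta>\<bar> > \<epsilon> / (3 * B)}"
    proof (rule ccontr)
      assume "\<not> ?thesis"
      then obtain \<omega> where \<omega>: "\<omega> \<in> space M" "\<bar>avg F \<omega> - \<mu>\<bar> > \<epsilon>"
        and g: "\<bar>avg G \<omega> - \<gamma>\<bar> \<le> \<epsilon> / 3" and w: "\<bar>avg W \<omega> - \<delta>\<bar> \<le> \<epsilon> / (3 * B)"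
        by force
      have "B * (avg W \<omega> - \<delta>) \<le> B * (\<epsilon> / (3 * B))"
        using w B by (intro mult_left_mono) auto
      then have "B * avg W \<omega> - B * \<delta> \<le> \<epsilon> / 3"
        using B by (simp add: right_diff_distrib)
      moreover have "B * \<delta> < \<epsilon> / 6"
        using mult_strict_left_mono[OF \<delta> B] B by simp
      ultimately show False
        using close[OF \<omega>(1)] \<omega>(2) g \<mu>\<gamma> by linarith
    qed
    then have "prob {\<omega>\<in>space M. \<bar>avg F \<omega> - \<mu>\<bar> > \<epsilon>} \<le>
        prob ({\<omega>\<in>space M. \<bar>avg G \<omega> - \<gamma>\<bar> > \<epsilon> / 3} \<union> {\<omega>\<in>space M. \<bar>avg W \<omega> - \<delta>\<bar> > \<epsilon> / (3 * B)})"
      by (intro finite_measure_mono) auto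
    also have "\<dots> \<le> prob {\<omega>\<in>space M. \<bar>avg G \<omega> - \<gamma>\<bar> > \<epsilon> / 3} +
        prob {\<omega>\<in>space M. \<bar>avg W \<omega> - \<delta>\<bar> > \<epsilon> / (3 * B)}"
      by (intro measure_Un_le) auto
    also have "\<dots> \<le> C1 * exp (- c1 * v) + C2 * exp (- c2 * v)"
      using 1(3)[OF n] 2(3)[OF n] unfolding avg_def \<gamma>_def \<delta>_def I_def v_def
      by (rule add_mono)
    also have "\<dots> \<le> C1 * exp (- min c1 c2 * v) + C2 * exp (- min c1 c2 * v)"
      using 1(1) 2(1) v by (intro add_mono mult_left_mono) auto
    also have "\<dots> = (C1 + C2) * exp (- min c1 c2 * v)"
      by (simp add: distrib_right)
    finally show "measure P {\<omega> \<in> space P.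
        \<bar>(1 / real n ^ CARD('d)) * (\<Sum>i\<in>positive_box n. Y i \<omega>) - (LINT \<omega>|P. Y 0 \<omega>)\<bar> > \<epsilon>}
        \<le> (C1 + C2) * exp (- min c1 c2 * real n ^ CARD('d))"
      using transfer[of v I] unfolding avg_def by (simp add: mean \<mu>_def v_def I_def)
  qed
qed

end
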